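(* For all integers $d_0$ and $d_1$ with $d_0>d_1\ge 1$, the following identity holds, with $q$ a formal variable: $$ \sum_{m\ge 1}\ \sum_{(k_0;\,k_1,\dots,k_m;\,n_1,\dots,n_m)} \begin{bmatrix} 2d_1\\ k_0\end{bmatrix}_q\ \prod_{i=1}^m \begin{bmatrix} 2d_0-2\sum_{j=1}^{i-1}(n_j-n_i)k_j\\ k_i\end{bmatrix}_q =\frac{[2d_0]_q}{[d_0]_q}\begin{bmatrix} d_0\\ d_1\end{bmatrix}_q\begin{bmatrix} d_0+d_1-1\\ d_0\end{bmatrix}_q , $$ where, for each $m\ge 1$, the inner sum runs over all integers $k_0\ge 0$, all integers $k_1,\dots,k_m>0$ and all integers $n_1>n_2>\dots>n_m>0$ such that $$k_1+\dots+k_m=d_1-k_0\qquad\text{and}\qquad n_1k_1+\dots+n_mk_m=d_0-d_1 .$$ (For $i=1$ the factor in the product is $\begin{bmatrix} 2d_0\\ k_1\end{bmatrix}_q$. For fixed $d_0,d_1$ the whole sum is finite.)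
   Context: The $q$-integers are defined symmetrically by $[\alpha]_q:=q^{\alpha/2}-q^{-\alpha/2}$. For integers $n,k$, the $q$-binomial coefficient is defined by $$\begin{bmatrix} n\\k\end{bmatrix}_q:=\frac{[n]_q[n-1]_q\cdots[n-k+1]_q}{[k]_q[k-1]_q\cdots[1]_q}\quad\text{if } 0\le k\le n,$$ and $\begin{bmatrix} n\\k\end{bmatrix}_q:=0$ otherwise (the empty product is $1$, so the value is $1$ for $k=0\le n$). Here $q$ (more precisely $q^{1/2}$) is a formal variable. *)

theory Defs
  imports
    "HOL-Computational_Algebra.Polynomial"
    "HOL-Computational_Algebra.Fraction_Field"
    "HOL-Library.FuncSet"
begin

text \<open>
  All identities live in the field of rational functions over the rationals in one formal
  variable. That variable plays the role of \<open>q\<close> to the power \<open>1/2\<close>, so the power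
  of \<open>q\<close> with exponent \<open>\<alpha>/2\<close> is \<open>qhalf powi \<alpha>\<close>.
\<close>

type_synonym qfield = "rat poly fract"

definition qhalf :: qfield where
  "qhalf = Fract [:0, 1:] 1"

definition q_int :: "int \<Rightarrow> qfield" where
  "q_int \<alpha> = qhalf powi \<alpha> - qhalf powi (- \<alpha>)"

definition q_binomial :: "int \<Rightarrow> int \<Rightarrow> qfield" where
  "q_binomial n k =
     (if 0 \<le> k \<and> k \<le> n
      then (\<Prod>i\<in>{1..k}. q_int (n - i + 1)) / (\<Prod>i\<in>{1..k}. q_int i)
      else 0)"

text \<open>
  The tuples \<open>k\<^sub>1, \<dots>, k\<^sub>m\<close> and \<open>n\<^sub>1, \<dots>, n\<^sub>m\<close> are functions on \<open>{1..m}\<close>; extensionality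
  fixes their values outside \<open>{1..m}\<close>, so that each tuple is counted exactly once.
\<close>

definition index_tuples ::
    "int \<Rightarrow> int \<Rightarrow> nat \<Rightarrow> (int \<times> (nat \<Rightarrow> int) \<times> (nat \<Rightarrow> int)) set" where
  "index_tuples d0 d1 m =
     {(k0, k, n).
        k0 \<ge> 0 \<and>
        k \<in> {1..m} \<rightarrow>\<^sub>E {0<..} \<and>
        n \<in> {1..m} \<rightarrow>\<^sub>E {0<..} \<and>
        (\<forall>i\<in>{1..m}. \<forall>j\<in>{1..m}. i < j \<longrightarrow> n i > n j) \<and>
        (\<Sum>i\<in>{1..m}. k i) = d1 - k0 \<and>
        (\<Sum>i\<in>{1..m}. n i * k i) = d0 - d1}"

text \<open>
  A sum over an infinite set is 0 by convention; the following shows that the sum over all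
  \<open>m \<ge> 1\<close> and all index tuples is a genuine finite sum.
\<close>

lemma finite_index_tuples: "finite (SIGMA m:{1..}. index_tuples d0 d1 m)"
proof (rule finite_subset)
  let ?B = "SIGMA m:{..nat d1}. {0..d1} \<times> ({1..m} \<rightarrow>\<^sub>E {0..d1}) \<times> ({1..m} \<rightarrow>\<^sub>E {0..d0 - d1})"
  show "finite ?B"
    by (intro finite_SigmaI finite_cartesian_product finite_PiE) auto
  show "(SIGMA m:{1..}. index_tuples d0 d1 m) \<subseteq> ?B"
  proof clarify
    fix m :: nat and k0 :: int and k n :: "nat \<Rightarrow> int"
    assume "(k0, k, n) \<in> index_tuples d0 d1 m"
    then have k0: "k0 \<ge> 0"
      and kE: "k \<in> {1..m} \<rightarrow>\<^sub>E {0<..}" and nE: "n \<in> {1..m} \<rightarrow>\<^sub>E {0<..}"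
      and sk: "(\<Sum>i\<in>{1..m}. k i) = d1 - k0"
      and snk: "(\<Sum>i\<in>{1..m}. n i * k i) = d0 - d1"
      by (auto simp: index_tuples_def)
    have kpos: "k i \<ge> 1" if "i \<in> {1..m}" for i
      using PiE_mem[OF kE that] by simp
    have npos: "n i \<ge> 1" if "i \<in> {1..m}" for i
      using PiE_mem[OF nE that] by simp
    have "(\<Sum>i\<in>{1..m}. 1) \<le> (\<Sum>i\<in>{1..m}. k i)"
      by (rule sum_mono) (rule kpos)
    then have m: "int m \<le> d1 - k0"
      using sk by simp
    have kle: "k i \<le> d1" if i: "i \<in> {1..m}" for i
    proof -
      have "k i \<le> (\<Sum>i\<in>{1..m}. k i)"
        by (rule member_le_sum[OF i]) (use kpos in force)+
      then show ?thesis using sk k0 by simp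
    qed
    have nle: "n i \<le> d0 - d1" if i: "i \<in> {1..m}" for i
    proof -
      have "n i * 1 \<le> n i * k i"
        by (rule mult_left_mono) (use kpos[OF i] npos[OF i] in auto)
      also have "\<dots> \<le> (\<Sum>i\<in>{1..m}. n i * k i)"
      proof (rule member_le_sum[OF i])
        show "0 \<le> n j * k j" if "j \<in> {1..m} - {i}" for j
          using kpos[of j] npos[of j] that by simp
      qed simp
      finally show ?thesis using snk by simp
    qed
    have "k \<in> {1..m} \<rightarrow>\<^sub>E {0..d1}"
      using kE kpos kle by (force simp: PiE_iff)
    moreover have "n \<in> {1..m} \<rightarrow>\<^sub>E {0..d0 - d1}"
      using nE npos nle by (force simp: PiE_iff)
    ultimately show "m \<in> {..nat d1} \<and>
        (k0, k, n) \<in> {0..d1} \<times> ({1..m} \<rightarrow>\<^sub>E {0..d1}) \<times> ({1..m} \<rightarrow>\<^sub>E {0..d0 - d1})"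
      using m k0 by auto
  qed
qed

end

theory Submission
  imports Defs
begin

text \<open>
  The indices \<open>k\<^sub>0; k\<^sub>1, \<dots>, k\<^sub>m; n\<^sub>1, \<dots>, n\<^sub>m\<close> describe a partition of \<open>L = d\<^sub>0 - d\<^sub>1\<close> into exactly
  \<open>a = d\<^sub>1\<close> parts, zero parts allowed: the part \<open>n\<^sub>i\<close> occurs \<open>k\<^sub>i\<close> times and the part \<open>0\<close> occurs
  \<open>k\<^sub>0\<close> times. The factor with lower entry \<open>k\<^sub>0\<close> has the same shape as the others. Indeed, for a
  part \<open>n = 0\<close> that follows all positive parts the upper entry would be
  \<open>2 d\<^sub>0 - 2 \<Sum>\<^sub>j n\<^sub>j k\<^sub>j = 2 d\<^sub>0 - 2 L = 2 d\<^sub>1\<close>.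

  The upper entries only depend on differences of parts. Hence removing the \<open>a - b\<close> zero parts of
  a partition and lowering the \<open>b\<close> remaining parts by 1 splits off one binomial factor and leaves
  the weight of a partition of \<open>L - b\<close> into \<open>b\<close> parts, provided that \<open>P = 2 d\<^sub>0\<close> is kept as a
  parameter independent of \<open>L\<close> and \<open>a\<close> (lemma \<open>weight_raise_parts\<close>). The weighted sum
  \<open>W(L, a)\<close> over all partitions therefore satisfies (lemma \<open>sum_weight_recursion\<close>)
  \[ W(L, a) = \sum_b {P - 2L \brack a - b}\, W(L - b, b). \]

  For this larger family there is still a product formula, which the recursion proves by
  induction on \<open>L\<close> (theorem \<open>sum_weight_padded_partitions\<close>):
  \[ W(L, a) = \frac{[P]}{[a]} {L + a - 1 \brack a - 1} {P - L - 1 \brack a - 1}. \]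
  Inserting it into the recursion, the common factor \<open>[P]\<close> cancels, and what has to be shown is
  an instance of the \<open>q\<close>-Pfaff-Saalschuetz summation of a balanced, terminating
  \<open>\<^sub>3\<phi>\<^sub>2\<close> series (theorem \<open>q_saalschutz\<close>). That summation is proved by creative
  telescoping in \<open>a\<close>; its certificate amounts to two instances of the three-term relation
  \<open>q_int_three_term\<close> between products of \<open>q\<close>-integers.
\<close>

section \<open>Symmetric \<open>q\<close>-integers\<close>

lemma qhalf_power: "qhalf ^ n = Fract (monom 1 n) 1"
proof (induction n)
  case 0
  show ?case by (simp add: One_fract_def)
next
  case (Suc n)
  have "([:0, 1:] :: rat poly) * monom 1 n = monom 1 (Suc n)"
    by (simp add: monom_Suc)
  then show ?case
    using Suc by (simp add: qhalf_def)
qed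

lemma qhalf_nonzero: "qhalf \<noteq> 0"
  by (simp add: qhalf_def Zero_fract_def eq_fract)

lemma qhalf_power_neq_1: "n > 0 \<Longrightarrow> qhalf ^ n \<noteq> 1"
  by (auto simp: qhalf_power One_fract_def eq_fract monom_eq_1_iff)

lemma q_int_0: "q_int 0 = 0"
  by (simp add: q_int_def)

lemma q_int_minus: "q_int (- x) = - q_int x"
  by (simp add: q_int_def)

lemma q_int_nonzero:
  assumes "x > 0"
  shows "q_int x \<noteq> 0"
proof
  assume "q_int x = 0"
  then have "qhalf powi x * qhalf powi x = qhalf powi x * qhalf powi (- x)"
    by (simp add: q_int_def)
  then have "qhalf powi (x + x) = 1"
    using qhalf_nonzero by (metis add.right_inverse power_int_0_right power_int_add)
  then have "qhalf ^ nat (x + x) = 1"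
    using assms by (simp add: power_int_def)
  then show False
    using qhalf_power_neq_1[of "nat (x + x)"] assms by simp
qed

lemma q_int_mult:
  "q_int x * q_int y =
     (qhalf powi (x + y) + qhalf powi (- (x + y))) -
     (qhalf powi (x - y) + qhalf powi (- (x - y)))"
proof -
  have "qhalf powi (x + y) = qhalf powi x * qhalf powi y"
    "qhalf powi (- (x + y)) = qhalf powi (- x) * qhalf powi (- y)"
    "qhalf powi (x - y) = qhalf powi x * qhalf powi (- y)"
    "qhalf powi (- (x - y)) = qhalf powi (- x) * qhalf powi y"
    using qhalf_nonzero by (simp_all flip: power_int_add)
  then show ?thesis
    by (simp add: q_int_def algebra_simps)
qed

text \<open>
  By \<open>q_int_mult\<close> a product of two \<open>q\<close>-integers is a difference of two values of the even function
  \<open>x \<mapsto> qhalf powi x + qhalf powi (- x)\<close>, at the sum and at the difference of the arguments. When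
  two products share the sum, that value cancels, and what is left is again a product.
\<close>

lemma q_int_three_term:
  assumes "x + y = u + v"
  shows "q_int x * q_int y - q_int u * q_int v = q_int (x - v) * q_int (u - x)"
proof -
  have y: "y = u + v - x" using assms by simp
  show ?thesis
    unfolding q_int_mult y by (simp add: algebra_simps)
qed

section \<open>Symmetric \<open>q\<close>-binomial coefficients\<close>

lemma q_binomial_0: "n \<ge> 0 \<Longrightarrow> q_binomial n 0 = 1"
  by (simp add: q_binomial_def)

lemma q_binomial_neg: "k < 0 \<Longrightarrow> q_binomial n k = 0"
  by (simp add: q_binomial_def)

lemma q_binomial_gt: "n < k \<Longrightarrow> q_binomial n k = 0"
  by (simp add: q_binomial_def)

lemma atLeast1AtMost_plus1_int: "(0::int) \<le> k \<Longrightarrow> {1..k + 1} = insert (k + 1) {1..k}"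
  by auto

lemma prod_q_int_nonzero: "(\<Prod>i\<in>{1..k}. q_int i) \<noteq> 0"
  by (simp add: q_int_nonzero)

lemma q_binomial_step:
  assumes "n \<ge> 0" "k \<ge> 0"
  shows "q_binomial n (k + 1) * q_int (k + 1) = q_binomial n k * q_int (n - k)"
proof -
  consider "k < n" | "k = n" | "k > n" by linarith
  then show ?thesis
  proof cases
    case 1
    have ins: "(\<Prod>i\<in>{1..k + 1}. f i) = f (k + 1) * (\<Prod>i\<in>{1..k}. f i)" for f :: "int \<Rightarrow> qfield"
      using assms by (simp add: atLeast1AtMost_plus1_int)
    show ?thesis
      using 1 assms q_int_nonzero[of "k + 1"] by (simp add: q_binomial_def ins)
  qed (simp_all add: q_binomial_gt q_int_0)
qed

lemma q_binomial_absorb: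
  assumes "n \<ge> 0" "k \<ge> 0"
  shows "q_binomial (n + 1) (k + 1) * q_int (k + 1) = q_int (n + 1) * q_binomial n k"
proof (cases "k \<le> n")
  case True
  have "(\<Prod>i\<in>{1..k + 1}. q_int (n + 1 - i + 1)) =
        q_int (n + 1) * (\<Prod>i\<in>{2..k + 1}. q_int (n + 1 - i + 1))"
  proof -
    have "{1..k + 1} = insert 1 {2..k + 1}" using assms by auto
    moreover have "q_int (n + 1 - 1 + 1) = q_int (n + 1)" by simp
    moreover have "finite {2..k + 1}" "1 \<notin> {2..k + 1}" by simp_all
    ultimately show ?thesis by (simp only: prod.insert not_False_eq_True)
  qed
  also have "(\<Prod>i\<in>{2..k + 1}. q_int (n + 1 - i + 1)) = (\<Prod>i\<in>{1..k}. q_int (n - i + 1))"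
    by (rule prod.reindex_bij_witness[of _ "\<lambda>i. i + 1" "\<lambda>i. i - 1"]) auto
  finally have num: "(\<Prod>i\<in>{1..k + 1}. q_int (n + 1 - i + 1)) =
        q_int (n + 1) * (\<Prod>i\<in>{1..k}. q_int (n - i + 1))" .
  have den: "(\<Prod>i\<in>{1..k + 1}. q_int i) = q_int (k + 1) * (\<Prod>i\<in>{1..k}. q_int i)"
    using assms by (simp add: atLeast1AtMost_plus1_int)
  have "q_binomial (n + 1) (k + 1) =
      (q_int (n + 1) * (\<Prod>i\<in>{1..k}. q_int (n - i + 1))) /
      (q_int (k + 1) * (\<Prod>i\<in>{1..k}. q_int i))"
    using True assms unfolding q_binomial_def num den by simp
  then show ?thesis
    using True assms q_int_nonzero[of "k + 1"] by (simp add: q_binomial_def)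
qed (simp add: q_binomial_gt)

lemma q_binomial_symmetric:
  assumes "0 \<le> k" "k \<le> n"
  shows "q_binomial n k = q_binomial n (n - k)"
proof -
  define F where "F = (\<lambda>k. \<Prod>i\<in>{1..k}. q_int i)"
  have F_nz: "F k \<noteq> 0" for k
    unfolding F_def by (rule prod_q_int_nonzero)
  have full: "q_binomial n k = F n / (F k * F (n - k))" if "0 \<le> k" "k \<le> n" for k
  proof -
    have num: "(\<Prod>i\<in>{1..k}. q_int (n - i + 1)) = (\<Prod>i\<in>{n - k + 1..n}. q_int i)"
      by (rule prod.reindex_bij_witness[of _ "\<lambda>i. n - i + 1" "\<lambda>i. n - i + 1"]) auto
    have "{1..n} = {1..n - k} \<union> {n - k + 1..n}"
      using that by auto
    then have "F n = F (n - k) * (\<Prod>i\<in>{n - k + 1..n}. q_int i)"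
      unfolding F_def by (simp add: prod.union_disjoint)
    then show ?thesis
      using that F_nz[of "n - k"] num by (simp add: q_binomial_def F_def)
  qed
  show ?thesis
    using full[of k] full[of "n - k"] assms by (simp add: mult.commute)
qed

section \<open>The \<open>q\<close>-Pfaff-Saalschuetz summation\<close>

lemma sum_telescope_int:
  fixes H :: "int \<Rightarrow> 'a::ab_group_add"
  assumes "a \<ge> 0"
  shows "(\<Sum>b\<in>{1..a}. H b - H (b + 1)) = H 1 - H (a + 1)"
  using assms
  by (induction a rule: int_ge_induct) (simp_all add: atLeast1AtMost_plus1_int)

text \<open>
  Up to a factor independent of \<open>b\<close>, this is the term with index \<open>b - 1\<close> of the balanced basic
  hypergeometric series \<open>\<^sub>3\<phi>\<^sub>2\<close> whose classical analogue is
  \[ {}_3F_2(1 - a,\; 1 - S,\; M + S + 1;\; 2,\; M - a + 2;\; 1). \]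
\<close>

definition saalschutz_term :: "int \<Rightarrow> int \<Rightarrow> int \<Rightarrow> int \<Rightarrow> qfield" where
  "saalschutz_term M S a b =
     q_binomial M (a - b) * q_binomial (S - 1) (b - 1) * q_binomial (M + S + b - 1) (b - 1) / q_int b"

text \<open>
  The right-hand side of the summation formula satisfies a first-order recurrence in \<open>a\<close>, with
  coefficients \<open>[a] [a + 1]\<close> and \<open>[S + a] [M + S - a]\<close>. Applied to a single term, the same
  recurrence operator gives a difference in \<open>b\<close>. The certificate \<open>H\<close> vanishes at \<open>b = 1\<close> because of
  its factor \<open>[b - 1]\<close>, and at \<open>b = a + 2\<close> because the term with parameter \<open>a + 1\<close> does.
  It is written through the term for \<open>a + 1\<close>, instead of as a rational multiple of the term for
  \<open>a\<close>, so that the boundary case \<open>b = a + 1\<close> needs no division by \<open>[a + 1 - b] = 0\<close>.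
\<close>

lemma saalschutz_term_telescopes:
  assumes "M \<ge> 0" "S \<ge> 1" "1 \<le> b" "b \<le> a + 1"
  defines "H \<equiv> \<lambda>b. q_int (b - 1) * q_int b * saalschutz_term M S (a + 1) b"
  shows "q_int a * q_int (a + 1) * saalschutz_term M S (a + 1) b
       - q_int (S + a) * q_int (M + S - a) * saalschutz_term M S a b = H b - H (b + 1)"
proof -
  \<comment> \<open>Primed binomials have the lower entry, and for \<open>C'\<close> also the upper entry, increased by 1.\<close>
  define A A' where "A = q_binomial M (a - b)" and "A' = q_binomial M (a + 1 - b)"
  define B C where "B = q_binomial (S - 1) (b - 1)" and "C = q_binomial (M + S + b - 1) (b - 1)"
  define B' C' where "B' = q_binomial (S - 1) b" and "C' = q_binomial (M + S + b) b"
  have A': "A' * q_int (a + 1 - b) = A * q_int (M + b - a)"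
  proof (cases "b = a + 1")
    case True
    then show ?thesis by (simp add: A_def q_binomial_neg q_int_0)
  next
    case False
    then show ?thesis
      using q_binomial_step[of M "a - b"] assms by (simp add: A_def A'_def algebra_simps)
  qed
  have B': "B' * q_int b = B * q_int (S - b)"
    using q_binomial_step[of "S - 1" "b - 1"] assms by (simp add: B_def B'_def)
  have C': "C' * q_int b = q_int (M + S + b) * C"
    using q_binomial_absorb[of "M + S + b - 1" "b - 1"] assms by (simp add: C_def C'_def)
  have ab: "q_int a * q_int (a + 1) - q_int (b - 1) * q_int b = q_int (a + b) * q_int (a + 1 - b)"
    using q_int_three_term[of "a + 1" "- a" b "1 - b"] q_int_minus[of a] q_int_minus[of "b - 1"]
      q_int_minus[of "a + 1 - b"]
    by (simp add: algebra_simps)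
  have MS: "q_int (S + a) * q_int (M + S - a) - q_int (S - b) * q_int (M + S + b) =
      q_int (M + b - a) * q_int (a + b)"
    using q_int_three_term[of "S + a" "M + S - a" "S - b" "M + S + b"]
      q_int_minus[of "a + b"] q_int_minus[of "M + b - a"]
    by (simp add: algebra_simps)
  have nz: "q_int b \<noteq> 0" "q_int (b + 1) \<noteq> 0"
    using assms by (simp_all add: q_int_nonzero)
  have Hb: "H b = q_int (b - 1) * A' * B * C"
    using nz by (simp add: H_def saalschutz_term_def A'_def B_def C_def)
  have "H (b + 1) = q_int b * A * B' * C'"
    using nz by (simp add: H_def saalschutz_term_def A_def B'_def C'_def add.assoc)
  then have "H (b + 1) * q_int b = A * (B' * q_int b) * (C' * q_int b)"
    by simp
  also have "\<dots> = A * B * C * q_int (S - b) * q_int (M + S + b)"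
    by (simp add: B' C')
  finally have Hb1: "H (b + 1) * q_int b = A * B * C * q_int (S - b) * q_int (M + S + b)" .
  have T: "saalschutz_term M S a b * q_int b = A * B * C"
    "saalschutz_term M S (a + 1) b * q_int b = A' * B * C"
    using nz by (simp_all add: saalschutz_term_def A_def A'_def B_def C_def)
  \<comment> \<open>After clearing the denominator \<open>[b]\<close>, the two three-term relations bring out the common
      factor \<open>[a + b]\<close>; the cofactor vanishes by the ratio \<open>A' / A\<close>.\<close>
  have "(q_int a * q_int (a + 1) * saalschutz_term M S (a + 1) b
       - q_int (S + a) * q_int (M + S - a) * saalschutz_term M S a b - (H b - H (b + 1))) * q_int b
      = q_int a * q_int (a + 1) * (saalschutz_term M S (a + 1) b * q_int b)
       - q_int (S + a) * q_int (M + S - a) * (saalschutz_term M S a b * q_int b)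
       - (H b * q_int b - H (b + 1) * q_int b)"
    by (simp add: algebra_simps)
  also have "\<dots> = B * C * ((q_int a * q_int (a + 1) - q_int (b - 1) * q_int b) * A'
      - A * (q_int (S + a) * q_int (M + S - a) - q_int (S - b) * q_int (M + S + b)))"
    unfolding T Hb Hb1 by (simp add: algebra_simps)
  also have "\<dots> = B * C * q_int (a + b) * (A' * q_int (a + 1 - b) - A * q_int (M + b - a))"
    unfolding ab MS by (simp add: algebra_simps)
  also have "\<dots> = 0"
    by (simp add: A')
  finally show ?thesis
    using nz by simp
qed

theorem q_saalschutz:
  assumes "M \<ge> 0" "S \<ge> 1" "a \<ge> 1"
  shows "(\<Sum>b\<in>{1..a}. saalschutz_term M S a b) =
     q_binomial (S + a - 1) (a - 1) * q_binomial (M + S - 1) (a - 1) / q_int a"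
  using \<open>a \<ge> 1\<close>
proof (induction a rule: int_ge_induct)
  case base
  show ?case
    using assms by (simp add: saalschutz_term_def q_binomial_0)
next
  case (step a)
  let ?H = "\<lambda>b. q_int (b - 1) * q_int b * saalschutz_term M S (a + 1) b"
  let ?T = "\<lambda>a. \<Sum>b\<in>{1..a}. saalschutz_term M S a b"
  have last: "saalschutz_term M S a (a + 1) = 0"
    by (simp add: saalschutz_term_def q_binomial_neg)
  have "q_int a * q_int (a + 1) * ?T (a + 1) - q_int (S + a) * q_int (M + S - a) * ?T a =
      (\<Sum>b\<in>{1..a + 1}. q_int a * q_int (a + 1) * saalschutz_term M S (a + 1) b
       - q_int (S + a) * q_int (M + S - a) * saalschutz_term M S a b)"
    using step.hyps last
    by (simp add: sum_subtractf atLeast1AtMost_plus1_int flip: sum_distrib_left)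
  also have "\<dots> = (\<Sum>b\<in>{1..a + 1}. ?H b - ?H (b + 1))"
    by (rule sum.cong[OF refl], rule saalschutz_term_telescopes) (use assms in auto)
  also have "\<dots> = ?H 1 - ?H (a + 1 + 1)"
    by (rule sum_telescope_int) (use step.hyps in simp)
  also have "\<dots> = 0"
    by (simp add: q_int_0 saalschutz_term_def q_binomial_neg)
  finally have rec: "q_int a * q_int (a + 1) * ?T (a + 1) =
      q_int (S + a) * q_int (M + S - a) * ?T a"
    by simp
  have S: "q_binomial (S + a) a * q_int a = q_int (S + a) * q_binomial (S + a - 1) (a - 1)"
    using q_binomial_absorb[of "S + a - 1" "a - 1"] assms step.hyps by simp
  have M: "q_binomial (M + S - 1) a * q_int a = q_binomial (M + S - 1) (a - 1) * q_int (M + S - a)"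
    using q_binomial_step[of "M + S - 1" "a - 1"] assms step.hyps by (simp add: algebra_simps)
  have nz: "q_int a \<noteq> 0" "q_int (a + 1) \<noteq> 0"
    using step.hyps by (simp_all add: q_int_nonzero)
  have "q_int a * q_int a * q_int (a + 1) * ?T (a + 1) =
     q_int a * (q_int a * q_int (a + 1) * ?T (a + 1))"
    by (simp add: mult_ac)
  also have "\<dots> = (q_int (S + a) * q_binomial (S + a - 1) (a - 1)) *
      (q_binomial (M + S - 1) (a - 1) * q_int (M + S - a))"
    unfolding rec step.IH using nz by simp
  also have "\<dots> = q_int a * q_int a * (q_binomial (S + a) a * q_binomial (M + S - 1) a)"
    unfolding S[symmetric] M[symmetric] by (simp add: mult_ac)
  finally have "q_int (a + 1) * ?T (a + 1) = q_binomial (S + a) a * q_binomial (M + S - 1) a"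
    using nz by (simp add: mult.assoc)
  then show ?case
    using nz by (simp add: field_simps)
qed

section \<open>Partitions with zero parts and their weights\<close>

text \<open>
  Here \<open>m = 0\<close> is allowed, in contrast to the index set of the identity: lowering all parts by 1
  can end in a partition with zero parts only, and that partition (for \<open>L = 0\<close>) is the base of the
  recursion.
\<close>

definition padded_partitions :: "int \<Rightarrow> int \<Rightarrow> (nat \<times> int \<times> (nat \<Rightarrow> int) \<times> (nat \<Rightarrow> int)) set" where
  "padded_partitions L a = (SIGMA m:UNIV. index_tuples (L + a) a m)"

text \<open>
  For \<open>P = 2 d\<^sub>0\<close> and \<open>L = d\<^sub>0 - d\<^sub>1\<close> this is the summand of the identity. The number \<open>P\<close> is a
  separate parameter because the recursion lowers \<open>L\<close> and keeps \<open>P\<close>.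
\<close>

definition weight :: "int \<Rightarrow> int \<Rightarrow> nat \<times> int \<times> (nat \<Rightarrow> int) \<times> (nat \<Rightarrow> int) \<Rightarrow> qfield" where
  "weight P L = (\<lambda>(m, k0, k, n). q_binomial (P - 2 * L) k0 *
     (\<Prod>i\<in>{1..m}. q_binomial (P - 2 * (\<Sum>j\<in>{1..<i}. (n j - n i) * k j)) (k i)))"

lemma padded_partitions_iff:
  "(m, k0, k, n) \<in> padded_partitions L a \<longleftrightarrow>
     k0 \<ge> 0 \<and> k \<in> extensional {1..m} \<and> n \<in> extensional {1..m} \<and>
     (\<forall>i\<in>{1..m}. k i > 0 \<and> n i > 0) \<and>
     (\<forall>i\<in>{1..m}. \<forall>j\<in>{1..m}. i < j \<longrightarrow> n i > n j) \<and>
     (\<Sum>i\<in>{1..m}. k i) = a - k0 \<and> (\<Sum>i\<in>{1..m}. n i * k i) = L"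
  by (auto simp: padded_partitions_def index_tuples_def PiE_iff)

lemma index_tuples_0:
  "index_tuples (L + a) a 0 = 
    (if L = 0 \<and> a \<ge> 0 then {(a, \<lambda>_. undefined, \<lambda>_. undefined)} else {})"
  by (auto simp: index_tuples_def)

lemma padded_partitions_eq_Un:
  "padded_partitions L a = ({0} \<times> index_tuples (L + a) a 0) \<union> (SIGMA m:{1..}. index_tuples (L + a) a m)"
  by (force simp: padded_partitions_def Suc_le_eq)

lemma finite_padded_partitions: "finite (padded_partitions L a)"
  unfolding padded_partitions_eq_Un index_tuples_0 by (intro finite_UnI finite_index_tuples) simp

text \<open>
  There are \<open>a - k0\<close> positive parts and each is at least 1, hence their total \<open>L\<close> is at least
  \<open>a - k0\<close>.
\<close>

lemma padded_partitions_bounds: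
  assumes "(m, k0, k, n) \<in> padded_partitions L a"
  shows "0 \<le> k0" "k0 \<le> a" "a - k0 \<le> L" "m > 0 \<Longrightarrow> k0 < a"
proof -
  have k: "\<And>i. i \<in> {1..m} \<Longrightarrow> k i \<ge> 1" and n: "\<And>i. i \<in> {1..m} \<Longrightarrow> n i \<ge> 1"
    and k0: "0 \<le> k0" and sk: "(\<Sum>i\<in>{1..m}. k i) = a - k0"
    and snk: "(\<Sum>i\<in>{1..m}. n i * k i) = L"
    using assms by (auto simp: padded_partitions_iff int_one_le_iff_zero_less)
  show "0 \<le> k0" by fact
  have "int m \<le> (\<Sum>i\<in>{1..m}. k i)"
    using sum_mono[of "{1..m}" "\<lambda>_. 1" k] k by simp
  then show "k0 \<le> a" "m > 0 \<Longrightarrow> k0 < a" using sk by auto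
  have "1 * k i \<le> n i * k i" if "i \<in> {1..m}" for i
    by (rule mult_right_mono) (use k[OF that] n[OF that] in auto)
  then have "(\<Sum>i\<in>{1..m}. k i) \<le> (\<Sum>i\<in>{1..m}. n i * k i)"
    by (intro sum_mono) simp
  then show "a - k0 \<le> L" using sk snk by simp
qed

section \<open>Removing the zero parts\<close>

text \<open>
  Adding 1 to every part turns the \<open>k0\<close> zero parts into parts equal to 1. As the values \<open>n i\<close>
  decrease, these form the new last block, with index \<open>Suc m\<close>; no block is created for \<open>k0 = 0\<close>
  since multiplicities of blocks are positive. The result is then padded with \<open>c\<close> zero parts.
\<close>

definition raise_parts where
  "raise_parts c = (\<lambda>(m, k0, k, n).
     if k0 = 0 then (m, c, k, restrict (\<lambda>i. n i + 1) {1..m})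
     else (Suc m, c, k(Suc m := k0), (restrict (\<lambda>i. n i + 1) {1..m})(Suc m := 1)))"

text \<open>
  The inverse operation forgets the zero parts, so that the block of parts equal to 1, if there is
  one, takes their place.
\<close>

definition lower_parts where
  "lower_parts = (\<lambda>(m, k0::int, k, n).
     if m > 0 \<and> n m = 1
     then (m - 1, k m, restrict k {1..m - 1}, restrict (\<lambda>i. n i - 1) {1..m - 1})
     else (m, 0, k, restrict (\<lambda>i. n i - 1) {1..m}))"

text \<open>
  Raising all \<open>b\<close> parts, the zero ones included, increases the total by \<open>b\<close>; padding with \<open>a - b\<close>
  new zero parts brings the number of parts to \<open>a\<close>.
\<close>

lemma raise_parts_mem:
  assumes t: "(m, k0, k, n) \<in> padded_partitions (L - b) b" and "b \<le> a"
  shows "raise_parts (a - b) (m, k0, k, n) \<in> padded_partitions L a"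
proof -
  let ?n = "restrict (\<lambda>i. n i + 1) {1..m}"
  have ext: "k \<in> extensional {1..m}" and pos: "\<And>i. i \<in> {1..m} \<Longrightarrow> k i > 0 \<and> n i > 0"
    and dec: "\<And>i j. i \<in> {1..m} \<Longrightarrow> j \<in> {1..m} \<Longrightarrow> i < j \<Longrightarrow> n i > n j"
    and k0: "k0 \<ge> 0" and sk: "(\<Sum>i\<in>{1..m}. k i) = b - k0"
    and snk: "(\<Sum>i\<in>{1..m}. n i * k i) = L - b"
    using t by (auto simp: padded_partitions_iff)
  have "(\<Sum>i\<in>{1..m}. ?n i * k i) = (\<Sum>i\<in>{1..m}. n i * k i + k i)"
    by (rule sum.cong) (auto simp: algebra_simps)
  then have sn: "(\<Sum>i\<in>{1..m}. ?n i * k i) = L - k0"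
    using sk snk by (simp add: sum.distrib)
  show ?thesis
  proof (cases "k0 = 0")
    case True
    have "?n i > 0" if "i \<in> {1..m}" for i using pos[OF that] that by simp
    moreover have "?n i > ?n j" if "i \<in> {1..m}" "j \<in> {1..m}" "i < j" for i j
      using dec[OF that] that by simp
    ultimately show ?thesis
      using True ext pos sk sn \<open>b \<le> a\<close> unfolding raise_parts_def
      by (simp del: restrict_apply add: padded_partitions_iff)
  next
    case False
    let ?k' = "k(Suc m := k0)" and ?n' = "?n(Suc m := 1)"
    have 1: "?k' \<in> extensional {1..Suc m}" "?n' \<in> extensional {1..Suc m}"
      using ext by (auto simp: extensional_def)
    have 2: "?k' i > 0 \<and> ?n' i > 0" if "i \<in> {1..Suc m}" for i
      using pos[of i] that k0 False by auto
    have 3: "?n' i > ?n' j" if "i \<in> {1..Suc m}" "j \<in> {1..Suc m}" "i < j" for i j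
      using dec[of i j] pos[of i] that by auto
    have "(\<Sum>i\<in>{1..m}. ?k' i) = (\<Sum>i\<in>{1..m}. k i)"
      by (rule sum.cong) auto
    then have 4: "(\<Sum>i\<in>{1..Suc m}. ?k' i) = b"
      using sk by simp
    have "(\<Sum>i\<in>{1..m}. ?n' i * ?k' i) = (\<Sum>i\<in>{1..m}. ?n i * k i)"
      by (rule sum.cong) auto
    then have 5: "(\<Sum>i\<in>{1..Suc m}. ?n' i * ?k' i) = L"
      using sn by simp
    have "(Suc m, a - b, ?k', ?n') \<in> padded_partitions L a"
      unfolding padded_partitions_iff using 1 2 3 4 5 \<open>b \<le> a\<close> by (intro conjI ballI impI) auto
    then show ?thesis
      using False by (simp add: raise_parts_def)
  qed
qed

lemma lower_parts_mem:
  assumes t: "(m, k0, k, n) \<in> padded_partitions L a"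
  shows "lower_parts (m, k0, k, n) \<in> padded_partitions (L - (a - k0)) (a - k0)"
proof -
  have ext: "k \<in> extensional {1..m}" and pos: "\<And>i. i \<in> {1..m} \<Longrightarrow> k i > 0 \<and> n i > 0"
    and dec: "\<And>i j. i \<in> {1..m} \<Longrightarrow> j \<in> {1..m} \<Longrightarrow> i < j \<Longrightarrow> n i > n j"
    and k0: "k0 \<ge> 0" and sk: "(\<Sum>i\<in>{1..m}. k i) = a - k0"
    and snk: "(\<Sum>i\<in>{1..m}. n i * k i) = L"
    using t by (auto simp: padded_partitions_iff)
  have sn: "(\<Sum>i\<in>{1..m}. (n i - 1) * k i) = L - (a - k0)"
    using sk snk by (simp add: algebra_simps sum_subtractf)
  show ?thesis
  proof (cases "m > 0 \<and> n m = 1")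
    case True
    then obtain l where l: "m = Suc l" and nm: "n (Suc l) = 1"
      using gr0_conv_Suc by auto
    let ?k = "restrict k {1..l}" and ?n = "restrict (\<lambda>i. n i - 1) {1..l}"
    have 2: "?k i > 0 \<and> ?n i > 0" if "i \<in> {1..l}" for i
      using pos[of i] dec[of i "Suc l"] that nm l by auto
    have 3: "?n i > ?n j" if "i \<in> {1..l}" "j \<in> {1..l}" "i < j" for i j
      using dec[of i j] that l by auto
    have "(\<Sum>i\<in>{1..l}. ?k i) = (\<Sum>i\<in>{1..l}. k i)"
      by (rule sum.cong) auto
    then have 4: "(\<Sum>i\<in>{1..l}. ?k i) = a - k0 - k m"
      using sk l by simp
    have "(\<Sum>i\<in>{1..l}. ?n i * ?k i) = (\<Sum>i\<in>{1..l}. (n i - 1) * k i)"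
      by (rule sum.cong) auto
    then have 5: "(\<Sum>i\<in>{1..l}. ?n i * ?k i) = L - (a - k0)"
      using sn l nm by simp
    have "k m \<ge> 0" using pos[of m] l by simp
    then have "(l, k m, ?k, ?n) \<in> padded_partitions (L - (a - k0)) (a - k0)"
      unfolding padded_partitions_iff using 2 3 4 5 by (intro conjI ballI impI) auto
    then show ?thesis
      using True l by (simp add: lower_parts_def)
  next
    case False
    let ?n = "restrict (\<lambda>i. n i - 1) {1..m}"
    \<comment> \<open>The smallest part \<open>n m\<close> differs from 1, so every part survives lowering as a positive one.\<close>
    have "n i > 1" if "i \<in> {1..m}" for i
    proof (cases "i = m")
      case True
      then show ?thesis using pos[of m] that False by auto
    next
      case False
      then show ?thesis using dec[of i m] pos[of m] that by auto
    qed
    then have 2: "k i > 0 \<and> ?n i > 0" if "i \<in> {1..m}" for i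
      using pos[of i] that by auto
    have 3: "?n i > ?n j" if "i \<in> {1..m}" "j \<in> {1..m}" "i < j" for i j
      using dec[of i j] that by auto
    have "(\<Sum>i\<in>{1..m}. ?n i * k i) = (\<Sum>i\<in>{1..m}. (n i - 1) * k i)"
      by (rule sum.cong) auto
    then have 5: "(\<Sum>i\<in>{1..m}. ?n i * k i) = L - (a - k0)"
      using sn by simp
    have "(m, 0, k, ?n) \<in> padded_partitions (L - (a - k0)) (a - k0)"
      unfolding padded_partitions_iff using ext sk 2 3 5 by (intro conjI ballI impI) auto
    moreover have "lower_parts (m, k0, k, n) = (m, 0, k, ?n)"
      using False by (auto simp: lower_parts_def)
    ultimately show ?thesis
      by simp
  qed
qed

lemma raise_lower_parts:
  assumes t: "(m, k0, k, n) \<in> padded_partitions L a"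
  shows "raise_parts k0 (lower_parts (m, k0, k, n)) = (m, k0, k, n)"
proof -
  have ext: "k \<in> extensional {1..m}" "n \<in> extensional {1..m}"
    and pos: "\<And>i. i \<in> {1..m} \<Longrightarrow> k i > 0 \<and> n i > 0"
    using t by (auto simp: padded_partitions_iff)
  show ?thesis
  proof (cases "m > 0 \<and> n m = 1")
    case True
    then obtain l where l: "m = Suc l" "n (Suc l) = 1"
      using gr0_conv_Suc by auto
    have "k (Suc l) \<noteq> 0" using pos[of "Suc l"] l by simp
    moreover have "(restrict k {1..l})(Suc l := k (Suc l)) = k"
      using ext l by (force simp: extensional_def fun_eq_iff)
    moreover have "(restrict (\<lambda>i. restrict (\<lambda>i. n i - 1) {1..l} i + 1) {1..l})(Suc l := 1) = n"
      using ext l by (force simp: extensional_def fun_eq_iff)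
    ultimately show ?thesis
      using l by (simp add: raise_parts_def lower_parts_def)
  next
    case False
    have "restrict (\<lambda>i. restrict (\<lambda>i. n i - 1) {1..m} i + 1) {1..m} = n"
      using ext by (force simp: extensional_def fun_eq_iff)
    then show ?thesis
      using False by (auto simp add: raise_parts_def lower_parts_def)
  qed
qed

lemma lower_raise_parts:
  assumes t: "(m, k0, k, n) \<in> padded_partitions L a"
  shows "lower_parts (raise_parts c (m, k0, k, n)) = (m, k0, k, n)"
proof -
  have ext: "k \<in> extensional {1..m}" "n \<in> extensional {1..m}"
    and pos: "\<And>i. i \<in> {1..m} \<Longrightarrow> k i > 0 \<and> n i > 0"
    using t by (auto simp: padded_partitions_iff)
  have n: "restrict (\<lambda>i. restrict (\<lambda>i. n i + 1) {1..m} i - 1) {1..m} = n"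
    using ext by (force simp: extensional_def fun_eq_iff)
  show ?thesis
  proof (cases "k0 = 0")
    case True
    have "restrict (\<lambda>i. n i + 1) {1..m} m \<noteq> 1" if "m > 0"
      using pos[of m] that by simp
    then show ?thesis
      using True n by (auto simp add: raise_parts_def lower_parts_def simp del: restrict_apply)
  next
    case False
    have "restrict (k(Suc m := k0)) {1..m} = k"
      using ext by (force simp: extensional_def fun_eq_iff)
    moreover have "restrict (\<lambda>i. ((restrict (\<lambda>i. n i + 1) {1..m})(Suc m := 1)) i - 1) {1..m} = n"
      using ext by (force simp: extensional_def fun_eq_iff)
    moreover have "raise_parts c (m, k0, k, n) =
        (Suc m, c, k(Suc m := k0), (restrict (\<lambda>i. n i + 1) {1..m})(Suc m := 1))"
      using False by (simp add: raise_parts_def)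
    ultimately show ?thesis
      by (simp only: lower_parts_def prod.case) simp
  qed
qed

text \<open>
  The old blocks keep their factors because their parts are all shifted by the same amount. The
  new block of parts equal to 1 has upper entry \<open>P - 2 \<Sum>\<^sub>j n\<^sub>j k\<^sub>j = P - 2 (L - b)\<close>, which is
  the upper entry of the factor that the zero parts had before. When there are no zero parts, no
  block is created and that factor is 1; this uses \<open>P \<ge> 2 * (L - b)\<close>, as the \<open>q\<close>-binomial
  coefficient with a negative upper entry is 0 by definition.
\<close>

lemma weight_raise_parts:
  assumes t: "(m, k0, k, n) \<in> padded_partitions (L - b) b" and "P \<ge> 2 * (L - b)"
  shows "weight P L (raise_parts c (m, k0, k, n)) =
    q_binomial (P - 2 * L) c * weight P (L - b) (m, k0, k, n)"
proof -
  let ?n = "restrict (\<lambda>i. n i + 1) {1..m}"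
  let ?F = "\<lambda>n k i. q_binomial (P - 2 * (\<Sum>j\<in>{1..<i}. (n j - n i) * k j)) (k i) :: qfield"
  have snk: "(\<Sum>i\<in>{1..m}. n i * k i) = L - b"
    using t by (auto simp: padded_partitions_iff)
  have F: "?F n' k' i = ?F n k i"
    if "i \<in> {1..m}" "\<And>j. j \<in> {1..m} \<Longrightarrow> n' j = n j + 1" "\<And>j. j \<in> {1..m} \<Longrightarrow> k' j = k j"
    for n' k' i
  proof -
    have "(\<Sum>j\<in>{1..<i}. (n' j - n' i) * k' j) = (\<Sum>j\<in>{1..<i}. (n j - n i) * k j)"
      by (rule sum.cong) (use that in auto)
    then show ?thesis using that by simp
  qed
  show ?thesis
  proof (cases "k0 = 0")
    case True
    have "(\<Prod>i\<in>{1..m}. ?F ?n k i) = (\<Prod>i\<in>{1..m}. ?F n k i)"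
      by (rule prod.cong[OF refl], rule F) auto
    then show ?thesis
      using True assms
      by (simp add: weight_def raise_parts_def q_binomial_0 del: restrict_apply)
  next
    case False
    let ?k' = "k(Suc m := k0)" and ?n' = "?n(Suc m := 1)"
    have "(\<Prod>i\<in>{1..m}. ?F ?n' ?k' i) = (\<Prod>i\<in>{1..m}. ?F n k i)"
      by (rule prod.cong[OF refl], rule F) auto
    moreover have "(\<Sum>j\<in>{1..<Suc m}. (?n' j - ?n' (Suc m)) * ?k' j) = (\<Sum>i\<in>{1..m}. n i * k i)"
      by (rule sum.cong) auto
    then have "?F ?n' ?k' (Suc m) = q_binomial (P - 2 * (L - b)) k0"
      using snk by simp
    ultimately have "(\<Prod>i\<in>{1..Suc m}. ?F ?n' ?k' i) =
        (\<Prod>i\<in>{1..m}. ?F n k i) * q_binomial (P - 2 * (L - b)) k0"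
      by (simp only: prod.cl_ivl_Suc) simp
    moreover have "raise_parts c (m, k0, k, n) = (Suc m, c, ?k', ?n')"
      using False by (simp add: raise_parts_def)
    ultimately show ?thesis
      by (simp only: weight_def prod.case mult_ac)
  qed
qed

text \<open>
  The partitions are grouped by the number \<open>b\<close> of their positive parts.
\<close>

lemma sum_weight_recursion:
  assumes "P \<ge> 2 * L"
  shows "(\<Sum>t\<in>padded_partitions L a. weight P L t) =
     (\<Sum>b\<in>{0..a}. q_binomial (P - 2 * L) (a - b) * (\<Sum>t\<in>padded_partitions (L - b) b. weight P (L - b) t))"
proof -
  let ?D = "SIGMA b:{0..a}. padded_partitions (L - b) b"
  have "(\<Sum>t\<in>padded_partitions L a. weight P L t) =
      (\<Sum>(b, t)\<in>?D. weight P L (raise_parts (a - b) t))"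
  proof (rule sum.reindex_bij_witness[where i = "\<lambda>(b, t). raise_parts (a - b) t"
        and j = "\<lambda>t. (a - fst (snd t), lower_parts t)"])
    fix t assume t: "t \<in> padded_partitions L a"
    obtain m k0 k n where tt: "t = (m, k0, k, n)" by (cases t)
    show 1: "(case (a - fst (snd t), lower_parts t) of (b, t) \<Rightarrow> raise_parts (a - b) t) = t"
      using raise_lower_parts t unfolding tt by simp
    show "(a - fst (snd t), lower_parts t) \<in> ?D"
      using lower_parts_mem padded_partitions_bounds t unfolding tt by simp
    show "(case (a - fst (snd t), lower_parts t) of (b, t) \<Rightarrow> weight P L (raise_parts (a - b) t)) =
        weight P L t"
      using 1 by simp
  next
    fix s assume s: "s \<in> ?D"
    obtain b m k0 k n where ss: "s = (b, m, k0, k, n)" by (cases s)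
    have "fst (snd (raise_parts (a - b) (m, k0, k, n))) = a - b"
      by (simp add: raise_parts_def)
    moreover have "lower_parts (raise_parts (a - b) (m, k0, k, n)) = (m, k0, k, n)"
      using s by (auto simp: ss intro: lower_raise_parts)
    ultimately show "(a - fst (snd (case s of (b, t) \<Rightarrow> raise_parts (a - b) t)),
          lower_parts (case s of (b, t) \<Rightarrow> raise_parts (a - b) t)) = s"
      unfolding ss by simp
    show "(case s of (b, t) \<Rightarrow> raise_parts (a - b) t) \<in> padded_partitions L a"
      using raise_parts_mem s unfolding ss by simp
  qed
  also have "\<dots> = (\<Sum>(b, t)\<in>?D. q_binomial (P - 2 * L) (a - b) * weight P (L - b) t)"
    by (rule sum.cong[OF refl]) (use assms in \<open>auto intro!: weight_raise_parts\<close>)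
  also have "\<dots> = (\<Sum>b\<in>{0..a}. \<Sum>t\<in>padded_partitions (L - b) b.
      q_binomial (P - 2 * L) (a - b) * weight P (L - b) t)"
    by (rule sum.Sigma[symmetric]) (simp_all add: finite_padded_partitions)
  finally show ?thesis
    by (simp add: sum_distrib_left)
qed

section \<open>The product formula\<close>

lemma padded_partitions_empty:
  "L < 0 \<Longrightarrow> padded_partitions L a = {}" "L > 0 \<Longrightarrow> padded_partitions L 0 = {}"
proof -
  show "padded_partitions L a = {}" if "L < 0"
    using padded_partitions_bounds that by fastforce
  show "padded_partitions L 0 = {}" if "L > 0"
  proof (rule ccontr)
    assume "padded_partitions L 0 \<noteq> {}"
    then obtain m k0 k n where t: "(m, k0, k, n) \<in> padded_partitions L 0" by (metis prod_cases4 equals0I)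
    then have "m = 0" using padded_partitions_bounds[OF t] by auto
    then show False using t that by (simp add: padded_partitions_iff)
  qed
qed

lemma padded_partitions_0:
  assumes "a \<ge> 0"
  shows "padded_partitions 0 a = {(0, a, \<lambda>_. undefined, \<lambda>_. undefined)}"
proof -
  have "(m, k0, k, n) \<in> padded_partitions 0 a \<longleftrightarrow>
    (m, k0, k, n) = (0, a, \<lambda>_. undefined, \<lambda>_. undefined)" for m k0 k n
    using padded_partitions_bounds[of m k0 k n 0 a] assms
    by (cases "m = 0") (auto simp: padded_partitions_iff)
  then show ?thesis by auto
qed

text \<open>
  The statement keeps \<open>P\<close> free, since the induction hypothesis is needed for the pairs
  \<open>(L - b, b)\<close> with the same \<open>P\<close>. The bound \<open>P \<ge> 2 * (L + a)\<close> is inherited by these pairs and keeps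
  all upper entries nonnegative. With the induction hypothesis inserted, the
  recursion is termwise \<open>[P]\<close> times the Saalschuetz sum for \<open>M = P - 2 L\<close> and \<open>S = L\<close>.
\<close>

theorem sum_weight_padded_partitions:
  assumes "L \<ge> 0" "a \<ge> 1" "P \<ge> 2 * (L + a)"
  shows "(\<Sum>t\<in>padded_partitions L a. weight P L t) =
    q_int P / q_int a * q_binomial (L + a - 1) (a - 1) * q_binomial (P - L - 1) (a - 1)"
  using assms
proof (induction "nat L" arbitrary: L a rule: less_induct)
  case less
  show ?case
  proof (cases "L = 0")
    case True
    have "q_binomial (a - 1) (a - 1) = 1"
      using prod_q_int_nonzero[of "a - 1"] less.prems
      by (simp add: q_binomial_def)
        (rule prod.reindex_bij_witness[of _ "\<lambda>i. a - i" "\<lambda>i. a - i"]; simp)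
    moreover have "q_binomial P a * q_int a = q_int P * q_binomial (P - 1) (a - 1)"
      using q_binomial_absorb[of "P - 1" "a - 1"] less.prems by simp
    moreover have "q_int a \<noteq> 0"
      using less.prems by (simp add: q_int_nonzero)
    ultimately show ?thesis
      using True less.prems by (simp add: padded_partitions_0 weight_def field_simps)
  next
    case False
    then have L: "L \<ge> 1" using less.prems by simp
    let ?f = "\<lambda>b. q_binomial (P - 2 * L) (a - b) *
      (\<Sum>t\<in>padded_partitions (L - b) b. weight P (L - b) t)"
    have f: "?f b = q_int P * saalschutz_term (P - 2 * L) L a b" if b: "b \<in> {1..a}" for b
    proof (cases "b \<le> L")
      \<comment> \<open>For \<open>b > L\<close> there are no partitions, in agreement with the vanishing of \<open>[L - 1; b - 1]\<close>.\<close>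
      case True
      have "(\<Sum>t\<in>padded_partitions (L - b) b. weight P (L - b) t) =
          q_int P / q_int b * q_binomial (L - 1) (b - 1) * q_binomial (P - L + b - 1) (b - 1)"
        using less.hyps[of "L - b" b] True less.prems b by (simp add: algebra_simps)
      then show ?thesis
        by (simp add: saalschutz_term_def)
    next
      case False
      then show ?thesis
        by (simp add: padded_partitions_empty saalschutz_term_def q_binomial_gt)
    qed
    have "(\<Sum>t\<in>padded_partitions L a. weight P L t) = (\<Sum>b\<in>{0..a}. ?f b)"
      by (rule sum_weight_recursion) (use less.prems in simp)
    also have "\<dots> = (\<Sum>b\<in>{1..a}. ?f b)"
    proof -
      have "{0..a} = insert 0 {1..a}" using less.prems by auto
      then show ?thesis using L by (simp add: padded_partitions_empty)
    qed
    also have "\<dots> = q_int P * (\<Sum>b\<in>{1..a}. saalschutz_term (P - 2 * L) L a b)"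
      by (subst sum_distrib_left) (rule sum.cong[OF refl], rule f)
    also have "\<dots> = q_int P * (q_binomial (L + a - 1) (a - 1) *
        q_binomial (P - 2 * L + L - 1) (a - 1) / q_int a)"
      using q_saalschutz[of "P - 2 * L" L a] L less.prems by simp
    finally show ?thesis
      by simp
  qed
qed

theorem theorem1:
  fixes d0 d1 :: int
  assumes "d0 > d1" and "d1 \<ge> 1"
  shows "(\<Sum>(m, k0, k, n) \<in> (SIGMA m:{1..}. index_tuples d0 d1 m).
            q_binomial (2 * d1) k0 *
            (\<Prod>i\<in>{1..m}.
               q_binomial (2 * d0 - 2 * (\<Sum>j\<in>{1..<i}. (n j - n i) * k j)) (k i)))
         = q_int (2 * d0) / q_int d0 * q_binomial d0 d1 * q_binomial (d0 + d1 - 1) d0"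
proof -
  \<comment> \<open>There are no tuples with \<open>m = 0\<close>, since the empty sum cannot equal \<open>d0 - d1 > 0\<close>.\<close>
  have dom: "(SIGMA m:{1..}. index_tuples d0 d1 m) = padded_partitions (d0 - d1) d1"
    using index_tuples_0[of "d0 - d1" d1] assms by (simp add: padded_partitions_eq_Un)
  \<comment> \<open>Absorption trades \<open>[d0 - 1; d1 - 1] / [d1]\<close> for \<open>[d0; d1] / [d0]\<close>, and symmetry turns the
      lower entry \<open>d1 - 1\<close> of the last coefficient into \<open>d0\<close>.\<close>
  have absorb: "q_binomial d0 d1 * q_int d1 = q_int d0 * q_binomial (d0 - 1) (d1 - 1)"
    using q_binomial_absorb[of "d0 - 1" "d1 - 1"] assms by simp
  have nz: "q_int d0 \<noteq> 0" "q_int d1 \<noteq> 0"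
    using assms by (simp_all add: q_int_nonzero)
  have "(\<Sum>t\<in>padded_partitions (d0 - d1) d1. weight (2 * d0) (d0 - d1) t) =
      q_int (2 * d0) / q_int d1 * q_binomial (d0 - 1) (d1 - 1) * q_binomial (d0 + d1 - 1) (d1 - 1)"
    using sum_weight_padded_partitions[of "d0 - d1" d1 "2 * d0"] assms by simp
  also have "\<dots> = q_int (2 * d0) / q_int d0 * q_binomial d0 d1 * q_binomial (d0 + d1 - 1) d0"
    using absorb nz q_binomial_symmetric[of "d1 - 1" "d0 + d1 - 1"] assms by (simp add: field_simps)
  finally show ?thesis
    unfolding dom weight_def by simp
qed

end
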